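(* Let $s>0$. Then $\#\Lambda(2^{-ms},\rho^*(s))=1$ for $m=0$ and $\#\Lambda(2^{-ms},\rho^*(s))=3$ for $m=1$. For every integer $m\ge1$ the following two estimates hold: (i) $\#\Lambda(2^{-ms},\rho^*(s))\le 2^{m+4\sqrt{m}}$; (ii) $\#\Lambda(2^{-ms},\rho^*(s))\le C m^{-3/4}2^{m+c\sqrt{m}}$, where $C:=(1-2^{-1/4})^{-1}$ and $c:=\pi\sqrt{\tfrac{2}{3}}\,(\ln 2)^{-1}<4$. Superimposing these inequalities, one obtains $$\#\Lambda(2^{-ms},\rho^*(s))\le\begin{cases}2^{m+4\sqrt{m}}, & 2\le m\le 5,\\ C m^{-3/4}2^{m+c\sqrt{m}}, & m\ge 6.\end{cases}$$
   Context: $\mathcal{F}$ is the set of all sequences $\nu=(\nu_1,\nu_2,\dots)$ with entries in $\mathbb{N}_0=\{0,1,2,\dots\}$ and only finitely many nonzero entries; $\rho^\nu=\prod_j\rho_j^{\nu_j}$ and $\rho^{-\nu}=1/\rho^\nu$. For $\varepsilon>0$ and a positive sequence $\rho$, $\Lambda(\varepsilon,\rho)=\{\nu\in\mathcal{F}:\rho^{-\nu}\ge\varepsilon\}$. Let $I_1=\{1,2\}$ and $I_k=\{j\in\mathbb{N}:2^{k-1}<j\le2^k\}$ for $k\ge2$. For $s>0$ the sequence $\rho^*(s)$ is defined by $\rho^*_j(s)=2^{ks}$ for $j\in I_k$, $k=1,2,\dots$. *)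

theory Defs
  imports "HOL-Analysis.Analysis"
begin

text \<open>Sequences indexed by \<open>1, 2, \<dots>\<close> are functions on \<^typ>\<open>nat\<close>. The index \<open>0\<close> is
  not part of a sequence: elements of \<open>fin_seqs\<close> vanish there, so that each sequence is
  represented by exactly one function, and the value \<open>\<rho> 0\<close> is never used.\<close>

definition fin_seqs :: "(nat \<Rightarrow> nat) set" where
  "fin_seqs = {\<nu>. \<nu> 0 = 0 \<and> finite {j. \<nu> j \<noteq> 0}}"

definition seq_pow :: "(nat \<Rightarrow> real) \<Rightarrow> (nat \<Rightarrow> nat) \<Rightarrow> real" where
  "seq_pow \<rho> \<nu> = (\<Prod>j \<in> {j. j \<ge> 1 \<and> \<nu> j \<noteq> 0}. \<rho> j ^ \<nu> j)"

definition Lambda_set :: "real \<Rightarrow> (nat \<Rightarrow> real) \<Rightarrow> (nat \<Rightarrow> nat) set" where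
  "Lambda_set \<epsilon> \<rho> = {\<nu> \<in> fin_seqs. 1 / seq_pow \<rho> \<nu> \<ge> \<epsilon>}"

definition dyadic_block :: "nat \<Rightarrow> nat set" where
  "dyadic_block k = (if k = 1 then {1, 2} else {j. 2 ^ (k - 1) < j \<and> j \<le> 2 ^ k})"

definition rho_star :: "real \<Rightarrow> nat \<Rightarrow> real" where
  "rho_star s j = 2 powr (real (THE k. k \<ge> 1 \<and> j \<in> dyadic_block k) * s)"

text \<open>The blocks with \<open>k \<ge> 1\<close> partition the positive integers, so the description in
  \<open>rho_star\<close> denotes the unique block index of each \<open>j \<ge> 1\<close>.\<close>

lemma dyadic_block_unique:
  assumes "k \<ge> 1" "j \<in> dyadic_block k" "l \<ge> 1" "j \<in> dyadic_block l"
  shows "k = l"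
proof -
  have *: False if "a < b" "a \<ge> 1" "j \<in> dyadic_block a" "j \<in> dyadic_block b" for a b
  proof -
    have "j \<le> 2 ^ a"
      using that by (auto simp: dyadic_block_def split: if_splits)
    moreover have "(2::nat) ^ a \<le> 2 ^ (b - 1)"
      using that by (intro power_increasing) auto
    moreover have "2 ^ (b - 1) < j"
      using that by (auto simp: dyadic_block_def split: if_splits)
    ultimately show False by linarith
  qed
  show ?thesis using *[of k l] *[of l k] assms by (meson linorder_neqE_nat)
qed

lemma dyadic_block_cover:
  assumes "j \<ge> 1"
  shows "\<exists>k\<ge>1. j \<in> dyadic_block k"
proof (cases "j \<le> 2")
  case True
  then have "j \<in> dyadic_block 1" using assms by (auto simp: dyadic_block_def)
  then show ?thesis by blast
next
  case False
  define k where "k = (LEAST k. j \<le> 2 ^ k)"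
  have ex: "j \<le> 2 ^ j" by (simp add: less_imp_le)
  have le: "j \<le> 2 ^ k" unfolding k_def by (rule LeastI[of _ j]) (rule ex)
  have "k \<noteq> 0" using le False by (intro notI) simp
  have "k \<noteq> 1" using le False by (intro notI) simp
  have "\<not> j \<le> 2 ^ (k - 1)"
    using not_less_Least[of "k - 1" "\<lambda>k. j \<le> 2 ^ k"] \<open>k \<noteq> 0\<close> by (auto simp: k_def[symmetric])
  then have "j \<in> dyadic_block k" using le \<open>k \<noteq> 1\<close> by (auto simp: dyadic_block_def)
  then show ?thesis using \<open>k \<noteq> 0\<close> by (intro exI[of _ k]) auto
qed

lemma rho_star_eq:
  assumes "k \<ge> 1" "j \<in> dyadic_block k"
  shows "rho_star s j = 2 powr (real k * s)"
proof -
  have "(THE k. k \<ge> 1 \<and> j \<in> dyadic_block k) = k"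
    using assms dyadic_block_unique by (intro the_equality) auto
  then show ?thesis by (simp add: rho_star_def)
qed

definition const_C :: real where
  "const_C = 1 / (1 - 2 powr (-1/4))"

definition const_c :: real where
  "const_c = pi * sqrt (2/3) / ln 2"

end

theory Submission
  imports Defs
begin

text \<open>Writing \<open>weight \<nu> = (\<Sum>j. k(j) * \<nu> j)\<close>, where \<open>k(j)\<close> is the index of the block containing \<open>j\<close>,
  the condition \<open>\<nu> \<in> \<Lambda>(2 powr (-m s), \<rho>*(s))\<close> becomes \<open>weight \<nu> \<le> m\<close>. Rankin's trick bounds the number
  of such \<open>\<nu>\<close> by \<open>x ^ -m\<close> times the Euler product \<open>\<Prod>j. 1 / (1 - x ^ k(j))\<close> for every \<open>x < 1/2\<close>.
  With \<open>x = exp (-t) / 2\<close> the product is at most \<open>2 exp (1 + 1 / (2 t))\<close>, and the optimal choice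
  \<open>t = 1 / sqrt (2 m)\<close> gives \<open>2 * 2 ^ m * exp (1 + sqrt (2 m))\<close>. Since \<open>sqrt 2 < const_c * ln 2 < 4 ln 2\<close>,
  this leaves room in the exponent to absorb the constants and the factor \<open>m powr (-3/4)\<close>.\<close>

section \<open>Block indices and the weight of a sequence\<close>

definition block_index :: "nat \<Rightarrow> nat" where
  "block_index j = (THE k. k \<ge> 1 \<and> j \<in> dyadic_block k)"

definition weight :: "(nat \<Rightarrow> nat) \<Rightarrow> nat" where
  "weight \<nu> = (\<Sum>j | j \<ge> 1 \<and> \<nu> j \<noteq> 0. block_index j * \<nu> j)"

lemma block_index_eq:
  assumes "k \<ge> 1" "j \<in> dyadic_block k"
  shows "block_index j = k"
  unfolding block_index_def using assms dyadic_block_unique by (intro the_equality) auto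

lemma block_index_1 [simp]: "block_index (Suc 0) = 1"
  and block_index_2 [simp]: "block_index 2 = 1"
  by (rule block_index_eq; simp add: dyadic_block_def)+

lemma block_index_between:
  assumes "m \<ge> 1" "2 ^ m < j" "j \<le> 2 ^ Suc m"
  shows "block_index j = Suc m"
  using assms by (intro block_index_eq) (auto simp: dyadic_block_def)

lemma block_index_ge_1: "j \<ge> 1 \<Longrightarrow> block_index j \<ge> 1"
  using dyadic_block_cover block_index_eq by metis

lemma le_two_power_block_index:
  assumes "j \<ge> 1"
  shows "j \<le> 2 ^ block_index j"
proof -
  obtain k where k: "k \<ge> 1" "j \<in> dyadic_block k"
    using dyadic_block_cover assms by blast
  then show ?thesis
    by (simp add: block_index_eq) (auto simp: dyadic_block_def split: if_splits)
qed

lemma seq_pow_rho_star: "seq_pow (rho_star s) \<nu> = 2 powr (real (weight \<nu>) * s)"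
  unfolding seq_pow_def weight_def rho_star_def block_index_def[symmetric]
  by (simp add: powr_power powr_sum sum_distrib_left mult_ac)

text \<open>Both sides of the defining inequality are powers of 2 with exponents proportional to
  \<open>s > 0\<close>, so \<open>s\<close> cancels and all further counting is independent of
  it.\<close>

lemma Lambda_set_rho_star:
  assumes "s > 0"
  shows "Lambda_set (2 powr (- (real m * s))) (rho_star s) = {\<nu> \<in> fin_seqs. weight \<nu> \<le> m}"
  using assms by (simp add: Lambda_set_def seq_pow_rho_star powr_minus field_simps)

lemma weight_eq_sum:
  assumes "finite J" "0 \<notin> J" "{j. \<nu> j \<noteq> 0} \<subseteq> J"
  shows "weight \<nu> = (\<Sum>j\<in>J. block_index j * \<nu> j)"
  unfolding weight_def
proof (intro sum.mono_neutral_left ballI assms(1))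
  show "{j. j \<ge> 1 \<and> \<nu> j \<noteq> 0} \<subseteq> J" using assms(3) by auto
  fix j assume "j \<in> J - {j. j \<ge> 1 \<and> \<nu> j \<noteq> 0}"
  moreover from this have "j \<ge> 1" using assms(2) by (cases j) auto
  ultimately show "block_index j * \<nu> j = 0" by simp
qed

text \<open>A nonzero entry at \<open>j\<close> alone adds at least \<open>block_index j\<close> to
  the weight, and \<open>j\<close> is at most \<open>2 ^ block_index j\<close>.\<close>

lemma weight_le_support:
  assumes "\<nu> \<in> fin_seqs" "weight \<nu> \<le> m"
  shows "{j. \<nu> j \<noteq> 0} \<subseteq> {1..2 ^ m}"
proof
  fix j assume "j \<in> {j. \<nu> j \<noteq> 0}"
  then have nz: "\<nu> j \<noteq> 0" by simp
  with assms have j: "j \<ge> 1" by (cases j) (auto simp: fin_seqs_def)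
  have "finite {j. \<nu> j \<noteq> 0}" using assms by (simp add: fin_seqs_def)
  then have "finite {j. j \<ge> 1 \<and> \<nu> j \<noteq> 0}" by (rule rev_finite_subset) auto
  then have "block_index j * \<nu> j \<le> weight \<nu>"
    unfolding weight_def using nz j by (intro member_le_sum) auto
  moreover have "block_index j \<le> block_index j * \<nu> j" using nz by simp
  ultimately have "block_index j \<le> m" using assms by linarith
  then have "(2::nat) ^ block_index j \<le> 2 ^ m" by (intro power_increasing) auto
  with le_two_power_block_index[OF j] have "j \<le> 2 ^ m" by (rule order_trans)
  then show "j \<in> {1..2 ^ m}" using j by simp
qed

text \<open>All supports lie in one fixed finite interval, which gives the set the form of
  \<open>S\<close> in \<open>card_weighted_le\<close>.\<close>

lemma weight_le_set_eq:
  "{\<nu> \<in> fin_seqs. weight \<nu> \<le> m} =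
   {\<nu>. {j. \<nu> j \<noteq> 0} \<subseteq> {1..2 ^ m} \<and> (\<Sum>j\<in>{1..2 ^ m}. block_index j * \<nu> j) \<le> m}"
  (is "?L = ?R")
proof (intro equalityI subsetI)
  fix \<nu> assume "\<nu> \<in> ?L"
  then show "\<nu> \<in> ?R"
    using weight_le_support[of \<nu> m] weight_eq_sum[of "{1..2 ^ m}" \<nu>] by simp
next
  fix \<nu> assume "\<nu> \<in> ?R"
  then have sub: "{j. \<nu> j \<noteq> 0} \<subseteq> {1..2 ^ m}"
    and le: "(\<Sum>j\<in>{1..2 ^ m}. block_index j * \<nu> j) \<le> m" by simp_all
  have "finite {j. \<nu> j \<noteq> 0}" using sub by (rule finite_subset) simp
  moreover have "\<nu> 0 = 0"
    using subsetD[OF sub, of 0] by (cases "\<nu> 0 = 0") simp_all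
  ultimately show "\<nu> \<in> ?L"
    using le weight_eq_sum[of "{1..2 ^ m}" \<nu>] sub by (simp add: fin_seqs_def)
qed

section \<open>Rankin's trick and the Euler product\<close>

text \<open>Each member of \<open>S\<close> satisfies \<open>x ^ m\<close> \<le>
  \<open>x ^ (\<Sum>j\<in>J. w j * \<nu> j)\<close>. Enlarging \<open>S\<close> to the box of all
  entries at most \<open>m\<close> lets the sum factor into truncated geometric series, one for each
  \<open>j\<close>.\<close>

lemma card_weighted_le:
  fixes x :: real and w :: "'a \<Rightarrow> nat" and m :: nat
  assumes "finite J" "\<And>j. j \<in> J \<Longrightarrow> w j \<ge> 1" "0 < x" "x < 1"
  defines "S \<equiv> {\<nu>. {j. \<nu> j \<noteq> 0} \<subseteq> J \<and> (\<Sum>j\<in>J. w j * \<nu> j) \<le> m}"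
  shows "finite S" "real (card S) * x ^ m \<le> (\<Prod>j\<in>J. 1 / (1 - x ^ w j))"
proof -
  let ?P = "PiE J (\<lambda>_. {..m})"
  have finP: "finite ?P" using assms by (intro finite_PiE) auto
  \<comment> \<open>Members of \<open>S\<close> are 0 outside \<open>J\<close>, whereas functions in
    \<open>PiE\<close> are \<open>undefined\<close> there; restriction passes from one convention to
    the other without loss.\<close>
  have inj: "inj_on (\<lambda>\<nu>. restrict \<nu> J) S"
  proof (rule inj_onI, rule ext)
    fix \<mu> \<nu> j assume "\<mu> \<in> S" "\<nu> \<in> S" and eq: "restrict \<mu> J = restrict \<nu> J"
    from fun_cong[OF eq, of j] have "j \<in> J \<Longrightarrow> \<mu> j = \<nu> j"
      by (simp add: restrict_apply')
    moreover have "j \<notin> J \<Longrightarrow> \<mu> j = 0" "j \<notin> J \<Longrightarrow> \<nu> j = 0"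
      using \<open>\<mu> \<in> S\<close> \<open>\<nu> \<in> S\<close> unfolding S_def by blast+
    ultimately show "\<mu> j = \<nu> j" by metis
  qed
  have sub: "(\<lambda>\<nu>. restrict \<nu> J) ` S \<subseteq> ?P"
  proof -
    have "\<nu> j \<le> m" if "\<nu> \<in> S" "j \<in> J" for \<nu> j
    proof -
      have "\<nu> j \<le> w j * \<nu> j" using assms that by auto
      also have "\<dots> \<le> (\<Sum>j\<in>J. w j * \<nu> j)" using assms that by (intro member_le_sum) auto
      also have "\<dots> \<le> m" using that by (simp add: S_def)
      finally show ?thesis .
    qed
    then show ?thesis by auto
  qed
  show "finite S" using inj sub finP by (meson finite_imageD finite_subset)
  have "real (card S) * x ^ m = (\<Sum>\<nu>\<in>S. x ^ m)" by simp
  also have "\<dots> \<le> (\<Sum>\<nu>\<in>S. x ^ (\<Sum>j\<in>J. w j * \<nu> j))"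
    using assms by (intro sum_mono power_decreasing) (auto simp: S_def)
  also have "\<dots> = (\<Sum>\<nu>\<in>S. \<Prod>j\<in>J. (x ^ w j) ^ restrict \<nu> J j)"
    by (simp add: power_sum power_mult)
  also have "\<dots> = (\<Sum>\<nu>\<in>(\<lambda>\<nu>. restrict \<nu> J) ` S. \<Prod>j\<in>J. (x ^ w j) ^ \<nu> j)"
    by (subst sum.reindex[OF inj]) simp
  also have "\<dots> \<le> (\<Sum>\<nu>\<in>?P. \<Prod>j\<in>J. (x ^ w j) ^ \<nu> j)"
    using assms by (intro sum_mono2 finP sub prod_nonneg) auto
  also have "\<dots> = (\<Prod>j\<in>J. \<Sum>i\<le>m. (x ^ w j) ^ i)"
    using assms by (simp add: prod_sum_PiE)
  also have "\<dots> \<le> (\<Prod>j\<in>J. 1 / (1 - x ^ w j))"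
  proof (intro prod_mono conjI sum_nonneg)
    fix j assume "j \<in> J"
    then have "norm (x ^ w j) < 1" using assms by (simp add: power_less_one_iff Suc_le_eq)
    then show "(\<Sum>i\<le>m. (x ^ w j) ^ i) \<le> 1 / (1 - x ^ w j)"
      using assms by (subst suminf_geometric[symmetric])
        (auto intro!: sum_le_suminf summable_geometric)
  qed (use assms in auto)
  finally show "real (card S) * x ^ m \<le> (\<Prod>j\<in>J. 1 / (1 - x ^ w j))" .
qed

text \<open>Block 1 has two elements instead of \<open>2 ^ 0\<close>, which accounts for the extra factor \<open>f 1\<close>.\<close>

lemma prod_block_index:
  fixes f :: "nat \<Rightarrow> real"
  assumes "m \<ge> 1"
  shows "(\<Prod>j\<in>{1..2 ^ m}. f (block_index j)) = f 1 * (\<Prod>k=1..m. f k ^ 2 ^ (k - 1))"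
  using assms
proof (induction m rule: dec_induct)
  case base
  have "{1..2 ^ 1} = {1, 2::nat}" by auto
  then show ?case by simp
next
  case (step m)
  have "{1..2 ^ Suc m} = {1..2 ^ m} \<union> {2 ^ m<..2 ^ Suc m :: nat}" by auto
  then have "(\<Prod>j\<in>{1..2 ^ Suc m}. f (block_index j))
      = (\<Prod>j\<in>{1..2 ^ m}. f (block_index j)) * (\<Prod>j\<in>{2 ^ m<..2 ^ Suc m}. f (block_index j))"
    by (simp only:) (rule prod.union_disjoint; auto)
  also have "(\<Prod>j\<in>{2 ^ m<..2 ^ Suc m}. f (block_index j)) = f (Suc m) ^ 2 ^ m"
    using step block_index_between by simp
  finally show ?case using step by simp
qed

text \<open>The product (1 + y + 2 y^2)(1 - y) equals 1 + y^2 (1 - 2 y), and the last term is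
  nonnegative for y \<le> 1/2.\<close>

lemma inverse_one_minus_le_exp:
  fixes y :: real
  assumes "0 \<le> y" "y \<le> 1 / 2"
  shows "1 / (1 - y) \<le> exp (y + 2 * y ^ 2)"
proof -
  have "0 \<le> y ^ 2 * (1 - 2 * y)" using assms by (intro mult_nonneg_nonneg) auto
  then have "1 \<le> (1 + (y + 2 * y ^ 2)) * (1 - y)"
    by (simp add: algebra_simps power2_eq_square)
  then have "1 / (1 - y) \<le> 1 + (y + 2 * y ^ 2)" using assms by (simp add: pos_divide_le_eq)
  also have "\<dots> \<le> exp (y + 2 * y ^ 2)" by (rule exp_ge_add_one_self)
  finally show ?thesis .
qed

lemma sum_powers_le:
  fixes q :: real
  assumes "0 \<le> q" "q < 1"
  shows "(\<Sum>k=1..m. q ^ k) \<le> q / (1 - q)"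
proof -
  have "(\<Sum>k=1..m. q ^ k) * (1 - q) = q - q ^ Suc m" by (induction m) (simp_all add: distrib_right, simp add: algebra_simps)
  also have "\<dots> \<le> q" using assms by simp
  finally show ?thesis using assms by (simp add: pos_le_divide_eq)
qed

text \<open>In the exponent, the linear terms of block \<open>k\<close> give
  \<open>2 ^ (k - 1) * x ^ k = exp (- t) ^ k / 2\<close>, a geometric series with sum at most
  \<open>1 / (2 * t)\<close>. The quadratic terms give at most
  \<open>2 ^ k * (1 / 4) ^ k = (1 / 2) ^ k\<close>, with sum at most 1.\<close>

lemma prod_generating_le:
  fixes t :: real
  assumes "t > 0"
  defines "x \<equiv> exp (- t) / 2"
  shows "(\<Prod>k=1..m. (1 / (1 - x ^ k)) ^ 2 ^ (k - 1)) \<le> exp (1 / (2 * t) + 1)"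
proof -
  have x: "0 < x" "x < 1 / 2" using assms by (auto simp: x_def)
  have t_le: "t \<le> exp t - 1" using exp_ge_add_one_self[of t] by linarith
  have "(\<Prod>k=1..m. (1 / (1 - x ^ k)) ^ 2 ^ (k - 1))
      \<le> (\<Prod>k=1..m. exp (exp (- t) ^ k / 2 + (1 / 2) ^ k))"
  proof (intro prod_mono conjI)
    fix k assume "k \<in> {1..m}"
    then obtain l where k: "k = Suc l" by (cases k) auto
    have "x ^ k \<le> (1 / 2) ^ k" using x by (intro power_mono) auto
    moreover have "(1 / 2 :: real) ^ k \<le> (1 / 2) ^ 1" unfolding k by (intro power_decreasing) auto
    ultimately have h: "x ^ k \<le> (1 / 2) ^ k" "x ^ k \<le> 1 / 2" by auto
    then show "0 \<le> (1 / (1 - x ^ k)) ^ 2 ^ (k - 1)" by simp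
    have sq: "(x ^ k) ^ 2 \<le> ((1 / 2) ^ k) ^ 2" using h x by (intro power_mono) auto
    have "(1 / (1 - x ^ k)) ^ 2 ^ (k - 1) \<le> exp (x ^ k + 2 * (x ^ k) ^ 2) ^ 2 ^ (k - 1)"
      using h x by (intro power_mono inverse_one_minus_le_exp) auto
    also have "\<dots> = exp (2 ^ l * x ^ k + 2 ^ k * (x ^ k) ^ 2)"
      by (simp add: k exp_of_nat_mult[symmetric] algebra_simps)
    also have "\<dots> \<le> exp (exp (- t) ^ k / 2 + (1 / 2) ^ k)"
    proof -
      have "2 ^ l * x ^ k = exp (- t) ^ k / 2" by (simp add: x_def k power_divide)
      moreover have "2 ^ k * (x ^ k) ^ 2 \<le> 2 ^ k * ((1 / 2) ^ k) ^ 2" using sq by simp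
      moreover have "2 ^ k * ((1 / 2 :: real) ^ k) ^ 2 = (1 / 2) ^ k"
        by (simp add: power2_eq_square power_divide)
      ultimately show ?thesis by simp
    qed
    finally show "(1 / (1 - x ^ k)) ^ 2 ^ (k - 1) \<le> exp (exp (- t) ^ k / 2 + (1 / 2) ^ k)" .
  qed
  also have "\<dots> = exp ((\<Sum>k=1..m. exp (- t) ^ k) / 2 + (\<Sum>k=1..m. (1 / 2) ^ k))"
    by (simp add: exp_sum sum_divide_distrib exp_add prod.distrib)
  also have "\<dots> \<le> exp (1 / (2 * t) + 1)"
  proof -
    have "(\<Sum>k=1..m. exp (- t) ^ k) \<le> exp (- t) / (1 - exp (- t))"
      using assms by (intro sum_powers_le) auto
    also have "\<dots> = 1 / (exp t - 1)" using assms by (simp add: exp_minus field_simps)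
    also have "\<dots> \<le> 1 / t" using t_le assms by (intro divide_left_mono) auto
    finally have "(\<Sum>k=1..m. exp (- t) ^ k) / 2 \<le> 1 / (2 * t)" by simp
    moreover have "(\<Sum>k=1..m. (1 / 2 :: real) ^ k) \<le> 1"
      using sum_powers_le[of "1 / 2" m] by simp
    ultimately show ?thesis by simp
  qed
  finally show ?thesis .
qed

lemma card_weight_le:
  assumes "m \<ge> 1"
  shows "real (card {\<nu> \<in> fin_seqs. weight \<nu> \<le> m}) \<le> 2 * 2 ^ m * exp (1 + sqrt 2 * sqrt (real m))"
proof -
  \<comment> \<open>This \<open>t\<close> balances \<open>1 / (2 * t)\<close> from the Euler product
    against \<open>m * t\<close> from \<open>x ^ m\<close>: both equal sqrt(m / 2).\<close>
  define t where "t = 1 / (sqrt 2 * sqrt (real m))"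
  define x where "x = exp (- t) / 2"
  let ?N = "real (card {\<nu> \<in> fin_seqs. weight \<nu> \<le> m})"
  have t: "t > 0" using assms by (simp add: t_def)
  have x: "0 < x" "x < 1 / 2" using t by (auto simp: x_def)
  have "?N * x ^ m \<le> (\<Prod>j\<in>{1..2 ^ m}. 1 / (1 - x ^ block_index j))"
    unfolding weight_le_set_eq using x block_index_ge_1 by (intro card_weighted_le) auto
  also have "\<dots> = 1 / (1 - x ^ 1) * (\<Prod>k=1..m. (1 / (1 - x ^ k)) ^ 2 ^ (k - 1))"
    using prod_block_index[OF assms, of "\<lambda>k. 1 / (1 - x ^ k)"] .
  \<comment> \<open>The surplus factor of block 1 is at most 2 because
    \<open>x < 1 / 2\<close>.\<close>
  also have "\<dots> \<le> 2 * exp (1 / (2 * t) + 1)"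
    using prod_generating_le[OF t, of m] x unfolding x_def[symmetric]
    by (intro mult_mono prod_nonneg) (auto simp: field_simps power_le_one)
  finally have "?N * x ^ m * (2 ^ m * exp (m * t)) \<le> 2 * exp (1 / (2 * t) + 1) * (2 ^ m * exp (m * t))"
    by (rule mult_right_mono) simp
  moreover have "x ^ m * (2 ^ m * exp (m * t)) = 1"
    by (simp add: x_def power_divide exp_of_nat_mult[symmetric] exp_minus field_simps)
  ultimately have "?N \<le> 2 * 2 ^ m * exp (1 + (1 / (2 * t) + m * t))"
    by (simp add: mult.assoc exp_add) (simp add: mult_ac)
  moreover have "1 / (2 * t) + m * t = sqrt 2 * sqrt (real m)"
  proof -
    have "sqrt 2 * sqrt 2 = 2" "sqrt (real m) * sqrt (real m) = real m" by auto
    then show ?thesis using assms by (simp add: t_def field_simps)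
  qed
  ultimately show ?thesis by simp
qed

section \<open>Finiteness and the exact counts for m = 0 and m = 1\<close>

lemma finite_weight_le: "finite {\<nu> \<in> fin_seqs. weight \<nu> \<le> m}"
  unfolding weight_le_set_eq using block_index_ge_1
  by (intro card_weighted_le(1)[where x = "1 / 2"]) auto

lemma card_weight_le_0: "card {\<nu> \<in> fin_seqs. weight \<nu> \<le> 0} = 1"
proof -
  have "{\<nu> \<in> fin_seqs. weight \<nu> \<le> 0} = {\<lambda>_. 0}"
    unfolding weight_le_set_eq by (auto simp: fun_eq_iff)
  then show ?thesis by simp
qed

lemma card_weight_le_1: "card {\<nu> \<in> fin_seqs. weight \<nu> \<le> 1} = 3"
proof -
  let ?e = "\<lambda>i j :: nat. if j = i then 1 else 0 :: nat"
  have eq: "{1..2 ^ 1} = {1, 2::nat}" by auto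
  have "{\<nu> \<in> fin_seqs. weight \<nu> \<le> 1} = {\<lambda>_. 0, ?e 1, ?e 2}" (is "?L = ?R")
  proof (intro equalityI subsetI)
    fix \<nu> assume "\<nu> \<in> ?L"
    then have sub: "{j. \<nu> j \<noteq> 0} \<subseteq> {1, 2}" and le: "\<nu> 1 + \<nu> 2 \<le> 1"
      unfolding weight_le_set_eq eq by simp_all
    have *: "\<nu> j = 0" if "j \<noteq> 1" "j \<noteq> 2" for j using sub that by blast
    from le consider "\<nu> 1 = 0" "\<nu> 2 = 0" | "\<nu> 1 = 1" "\<nu> 2 = 0" | "\<nu> 1 = 0" "\<nu> 2 = 1"
      by linarith
    then show "\<nu> \<in> ?R"
    proof cases
      case 1
      then have "\<nu> = (\<lambda>_. 0)" using * by (metis ext)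
      then show ?thesis by simp
    next
      case 2
      then have "\<nu> = ?e 1" using * by (intro ext) (metis)
      then show ?thesis by simp
    next
      case 3
      then have "\<nu> = ?e 2" using * by (intro ext) (metis)
      then show ?thesis by simp
    qed
  next
    fix \<nu> assume "\<nu> \<in> ?R"
    then show "\<nu> \<in> ?L" unfolding weight_le_set_eq eq by (auto split: if_splits)
  qed
  moreover have "(\<lambda>_. 0) \<noteq> ?e 1" "(\<lambda>_. 0) \<noteq> ?e 2" "?e 1 \<noteq> ?e 2"
    by (auto dest: fun_cong[of _ _ "1::nat"] fun_cong[of _ _ "2::nat"])
  ultimately show ?thesis by simp
qed

section \<open>Numerical bounds on the constants\<close>

lemma sqrt_two_thirds_bounds: "81 / 100 \<le> sqrt (2 / 3)" "sqrt (2 / 3) \<le> 82 / (100 :: real)"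
  by (rule real_le_rsqrt real_le_lsqrt; simp add: power2_eq_square)+

lemma sqrt_2_bounds: "141 / 100 \<le> sqrt 2" "sqrt 2 \<le> (142 / 100 :: real)"
  by (rule real_le_rsqrt real_le_lsqrt; simp add: power2_eq_square)+

lemma const_c_less_4: "const_c < 4"
proof -
  have "pi * sqrt (2 / 3) \<le> 3.15 * (82 / 100)"
    using pi_approx sqrt_two_thirds_bounds by (intro mult_mono) auto
  then show ?thesis unfolding const_c_def
    using ln2_ge_two_thirds by (simp add: divide_less_eq)
qed

text \<open>Numerically 3 * 0.81 = 2.43 > 2.42. The 1 beyond \<open>sqrt 2\<close> provides a spare
  factor \<open>exp (sqrt m)\<close> in the second estimate.\<close>

lemma const_c_ln_2: "const_c * ln 2 \<ge> 1 + sqrt 2"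
proof -
  have "3 * (81 / 100) \<le> pi * sqrt (2 / 3)"
    using pi_gt3 sqrt_two_thirds_bounds by (intro mult_mono) auto
  then show ?thesis using sqrt_2_bounds by (simp add: const_c_def)
qed

text \<open>This rests on (5/6)^4 = 625/1296 < 1/2. The value 6 suffices to absorb the constant 2 e,
  since e \<le> 3.\<close>

lemma const_C_ge_6: "const_C \<ge> 6"
proof -
  have p4: "(2 powr (-1/4)) ^ 4 = (1 / 2 :: real)"
    by (subst powr_power) (auto simp: powr_minus_divide)
  have "(5 / 6) ^ 4 \<le> (2 powr (-1/4) :: real) ^ 4" unfolding p4 by (simp add: power4_eq_xxxx)
  then have "5 / 6 \<le> (2 powr (-1/4) :: real)" using power_mono_iff by fastforce
  moreover have "(2 powr (-1/4) :: real) < 1" by (simp add: powr_less_one)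
  ultimately show ?thesis by (simp add: const_C_def le_divide_eq)
qed

text \<open>For u = sqrt(m) the left side is m^(3/4), so the spare \<open>exp u\<close> pays for the
  factor \<open>m powr (-3/4)\<close>. The arithmetic-geometric mean inequality brings
  \<open>u * sqrt u\<close> below the quadratic Taylor polynomial of \<open>exp\<close>.\<close>

lemma powr_three_halves_le_exp:
  fixes u :: real
  assumes "u > 0"
  shows "u powr (3 / 2) \<le> exp u"
proof -
  have "u powr (3 / 2) = u * sqrt u"
    using assms powr_add[of u 1 "1 / 2"] by (simp add: powr_half_sqrt)
  also have "\<dots> \<le> u * ((1 + u) / 2)"
    using assms arith_geo_mean_sqrt[of 1 u] by (intro mult_left_mono) auto
  also have "\<dots> \<le> 1 + u + u\<^sup>2 / 2" using assms by (simp add: power2_eq_square field_simps)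
  also have "\<dots> \<le> exp u" using assms by (intro exp_lower_Taylor_quadratic) auto
  finally show ?thesis .
qed

section \<open>The two estimates\<close>

lemma two_powr_eq_exp: "2 powr (real m + a * b) = 2 ^ m * exp (a * ln 2 * b)"
  by (simp add: powr_add powr_realpow) (simp add: powr_def mult_ac)

lemma card_weight_le_two_powr:
  assumes "m \<ge> 1"
  shows "real (card {\<nu> \<in> fin_seqs. weight \<nu> \<le> m}) \<le> 2 powr (real m + 4 * sqrt (real m))"
\<comment> \<open>At m = 1 the bound of \<open>card_weight_le\<close>, about 44.7, exceeds the
  target 2^5 = 32, so the exact count is used.\<close>
proof (cases "m = 1")
  case True
  have "(3::real) \<le> 2 powr 5" by simp
  then show ?thesis unfolding True card_weight_le_1 by simp
next
  case False
  define u where "u = sqrt (real m)"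
  have u: "141 / 100 \<le> u"
    using False assms sqrt_2_bounds(1) real_sqrt_le_mono[of 2 "real m"]
    unfolding u_def by linarith
  \<comment> \<open>For m \<ge> 2 the gap between the exponents is at least 1.24 * 1.41 = 1.7484,
    which just covers \<open>ln 2 + 1\<close> \<le> 61/36.\<close>
  have "4 * ln 2 - sqrt 2 \<ge> 124 / (100 :: real)" using ln2_ge_two_thirds sqrt_2_bounds by auto
  then have "(124 / 100) * (141 / 100) \<le> (4 * ln 2 - sqrt 2) * u"
    using u by (intro mult_mono) auto
  then have "ln 2 + (1 + sqrt 2 * u) \<le> 4 * ln 2 * u"
    using ln_2_less_1 ln2_le_25_over_36 by (simp add: algebra_simps)
  then have "exp (ln 2 + (1 + sqrt 2 * u)) \<le> exp (4 * ln 2 * u)" by simp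
  then have "2 * exp (1 + sqrt 2 * u) \<le> exp (4 * ln 2 * u)" by (simp add: exp_add[of "ln 2"])
  then have "2 ^ m * (2 * exp (1 + sqrt 2 * u)) \<le> 2 ^ m * exp (4 * ln 2 * u)" by simp
  with card_weight_le[OF assms] show ?thesis
    unfolding two_powr_eq_exp u_def by (simp only: mult_ac)
qed

lemma card_weight_le_const:
  assumes "m \<ge> 1"
  shows "real (card {\<nu> \<in> fin_seqs. weight \<nu> \<le> m})
    \<le> const_C * real m powr (-3/4) * 2 powr (real m + const_c * sqrt (real m))"
proof -
  define u where "u = sqrt (real m)"
  have u: "u > 0" "real m = u powr 2" using assms by (auto simp: u_def)
  have P: "real m powr (3/4) = u powr (3/2)" unfolding u(2) powr_powr by simp
  have "1 \<le> real m powr (-3/4) * exp u"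
    using powr_three_halves_le_exp[OF u(1)] u(1) P
    by (simp add: powr_minus_divide)
  have "2 * exp (1 + sqrt 2 * u) \<le> 6 * exp (sqrt 2 * u)"
    using exp_le by (simp add: exp_add)
  also have "\<dots> \<le> const_C * exp (sqrt 2 * u)" using const_C_ge_6 by simp
  also have "\<dots> \<le> const_C * (real m powr (-3/4) * exp u * exp (sqrt 2 * u))"
    using \<open>1 \<le> real m powr (-3/4) * exp u\<close> const_C_ge_6 by (intro mult_left_mono) auto
  also have "\<dots> = const_C * real m powr (-3/4) * exp ((1 + sqrt 2) * u)"
    by (simp add: exp_add algebra_simps)
  also have "\<dots> \<le> const_C * real m powr (-3/4) * exp (const_c * ln 2 * u)"
    using const_c_ln_2 const_C_ge_6 u by (intro mult_left_mono) auto
  finally have "2 ^ m * (2 * exp (1 + sqrt 2 * u))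
      \<le> 2 ^ m * (const_C * real m powr (-3/4) * exp (const_c * ln 2 * u))" by simp
  with card_weight_le[OF assms] show ?thesis
    unfolding two_powr_eq_exp u_def by (simp only: mult_ac)
qed

theorem lemma5p3:
  fixes s :: real
  assumes "s > 0"
  shows "(\<forall>m::nat. finite (Lambda_set (2 powr (- (real m * s))) (rho_star s)))
    \<and> card (Lambda_set (2 powr (- (real 0 * s))) (rho_star s)) = 1
    \<and> card (Lambda_set (2 powr (- (real 1 * s))) (rho_star s)) = 3
    \<and> (\<forall>m::nat. m \<ge> 1 \<longrightarrow>
         real (card (Lambda_set (2 powr (- (real m * s))) (rho_star s)))
           \<le> 2 powr (real m + 4 * sqrt (real m)))
    \<and> const_c < 4
    \<and> (\<forall>m::nat. m \<ge> 1 \<longrightarrow>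
         real (card (Lambda_set (2 powr (- (real m * s))) (rho_star s)))
           \<le> const_C * real m powr (-3/4) * 2 powr (real m + const_c * sqrt (real m)))
    \<and> (\<forall>m::nat. m \<ge> 2 \<longrightarrow>
         real (card (Lambda_set (2 powr (- (real m * s))) (rho_star s)))
           \<le> (if m \<le> 5 then 2 powr (real m + 4 * sqrt (real m))
               else const_C * real m powr (-3/4) * 2 powr (real m + const_c * sqrt (real m))))"
  unfolding Lambda_set_rho_star[OF assms]
  \<comment> \<open>The piecewise bound selects between two estimates that both hold for all m \<ge>
    1.\<close>
  using finite_weight_le card_weight_le_0 card_weight_le_1 const_c_less_4
    card_weight_le_two_powr card_weight_le_const
  by (auto simp del: One_nat_def)

end
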